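(* Let $\rho\in\mathbb{N}$ (so $\rho\ge1$), $p>0$, $R>0$, let $w_0\in E_{\rho,p}$ be such that $w_0'$ has $m\ge0$ zeros (counting multiplicities) in $D_R$ and no zeros on $\partial D_R$, and let $U\subset E_{\rho,p}$ be the neighborhood of $w_0$ used to define the Critical Values $R$-Truncated Discriminant $\mathrm{CVD}_{U,R}$. Then the functional $w\mapsto\mathrm{CVD}_{U,R}(w)$ is holomorphic in $U$.
   Context: $D_R=\{z\in\mathbb{C}:|z|<R\}$. $E_{\rho,p}$ is the complex vector space of entire functions $f$ with $\lim_{R\to\infty}\sup_{|z|\ge R}\frac{\ln|f(z)|}{|z|^\rho}\le p$, with the Fréchet topology generated by the norms $\|f\|_n=\sup_{z\in\mathbb{C}}\exp[-(p+1/n)|z|^\rho]|f(z)|$, $n\in\mathbb{N}$. A function $f:U\to\mathbb{C}$ on an open subset $U$ of a complex topological vector space is holomorphic if it is continuous in $U$ and, for all vectors $u,h$, the function $\lambda\mapsto f(u+\lambda h)$ is holomorphic on the open set of $\lambda\in\mathbb{C}$ with $u+\lambda h\in U$. Definition of $\mathrm{CVD}_{U,R}$: $U$ is an open neighborhood of $w_0$ in $E_{\rho,p}$ such that for each $w\in U$ the derivative $w'$ has exactly $m$ zeros in $D_R$ (counting multiplicities) and none on $\partial D_R$, and $w'(z)=P_m(w,z)\Phi(w,z)$ in $U\times D_R$, where $P_m(w,z)=z^m+a_{m-1}(w)z^{m-1}+\dots+a_0(w)$ is the monic polynomial in $z$ whose zeros are the zeros of $w'$ in $D_R$ with multiplicities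 ($P_m\equiv1$ if $m=0$), the $a_k$ are holomorphic in $U$, and $\Phi$ is holomorphic in $U\times D_R$ and nonvanishing (such $U$ exists). For $m\ge1$ let $C(w)$ be the $m\times m$ companion matrix of $P_m(w,\cdot)$ ($1$'s on the subdiagonal, last column $(-a_0(w),\dots,-a_{m-1}(w))^T$, other entries zero), let $$W(C)(w)=-\frac1{2\pi i}\oint_{\partial D_R}w(\zeta)\,(C(w)-\zeta I)^{-1}\,d\zeta ,$$ and let $\mathrm{CVD}_{U,R}(w)$ be the discriminant of the polynomial $\lambda\mapsto\det(W(C)(w)-\lambda I)$. For $m=0$ put $\mathrm{CVD}_{U,R}(w)=1$. *)

theory Defs
  imports
    "HOL-Complex_Analysis.Complex_Analysis"
    "HOL-Library.Function_Algebras"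
    "Jordan_Normal_Form.Gauss_Jordan_Elimination"
    "Subresultants.Resultant_Prelim"
begin

(* The extended-real quotient ln|f z| / |z|^rho, with the convention ln 0 = -infinity
   (the library's real ln satisfies ln 0 = 0). *)
definition log_growth :: "nat \<Rightarrow> (complex \<Rightarrow> complex) \<Rightarrow> complex \<Rightarrow> ereal" where
  "log_growth \<rho> f z = (if f z = 0 then -\<infinity> else ereal (ln (cmod (f z)) / cmod z ^ \<rho>))"

definition E_space :: "nat \<Rightarrow> real \<Rightarrow> (complex \<Rightarrow> complex) set" where
  "E_space \<rho> p = {f. f holomorphic_on UNIV \<and>
     Lim at_top (\<lambda>R::real. SUP z\<in>{z. R \<le> cmod z}. log_growth \<rho> f z) \<le> ereal p}"

definition E_norm :: "nat \<Rightarrow> real \<Rightarrow> nat \<Rightarrow> (complex \<Rightarrow> complex) \<Rightarrow> real" where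
  "E_norm \<rho> p n f = (SUP z. exp (- (p + 1 / real n) * cmod z ^ \<rho>) * cmod (f z))"

(* The Frechet topology: the open balls of all the norms (n >= 1) form a subbase.  Its
   topspace is E_space. *)
definition E_topology :: "nat \<Rightarrow> real \<Rightarrow> (complex \<Rightarrow> complex) topology" where
  "E_topology \<rho> p = topology_generated_by
     {{g \<in> E_space \<rho> p. E_norm \<rho> p n (\<lambda>z. g z - f z) < e} | f n e.
        f \<in> E_space \<rho> p \<and> n \<ge> 1 \<and> 0 < e}"

(* Holomorphy on an open subset U of a complex topological vector space, given by its
   topology X (with carrier topspace X) and its scalar multiplication. *)
definition tvs_holomorphic_on ::
  "(complex \<Rightarrow> 'v \<Rightarrow> 'v) \<Rightarrow> 'v topology \<Rightarrow> 'v set \<Rightarrow> ('v::ab_group_add \<Rightarrow> complex) \<Rightarrow> bool" where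
  "tvs_holomorphic_on smul X U f \<longleftrightarrow>
     openin X U \<and>
     continuous_map (subtopology X U) euclidean f \<and>
     (\<forall>u\<in>topspace X. \<forall>h\<in>topspace X.
        (\<lambda>c. f (u + smul c h)) holomorphic_on {c. u + smul c h \<in> U})"

definition scale_fun :: "complex \<Rightarrow> (complex \<Rightarrow> complex) \<Rightarrow> complex \<Rightarrow> complex" where
  "scale_fun c f = (\<lambda>z. c * f z)"

definition scale_fun_pair ::
  "complex \<Rightarrow> (complex \<Rightarrow> complex) \<times> complex \<Rightarrow> (complex \<Rightarrow> complex) \<times> complex" where
  "scale_fun_pair c x = (scale_fun c (fst x), c * snd x)"

definition disc_zeros :: "real \<Rightarrow> (complex \<Rightarrow> complex) \<Rightarrow> complex set" where
  "disc_zeros R f = {z \<in> ball 0 R. f z = 0}"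

(* f has exactly m zeros in the open disc, with multiplicities, and none on its boundary. *)
definition has_disc_zeros :: "real \<Rightarrow> nat \<Rightarrow> (complex \<Rightarrow> complex) \<Rightarrow> bool" where
  "has_disc_zeros R m f \<longleftrightarrow>
     finite (disc_zeros R f) \<and> (\<Sum>z\<in>disc_zeros R f. nat (zorder f z)) = m \<and>
     (\<forall>z\<in>sphere 0 R. f z \<noteq> 0)"

definition crit_poly :: "real \<Rightarrow> (complex \<Rightarrow> complex) \<Rightarrow> complex poly" where
  "crit_poly R w = (\<Prod>z\<in>disc_zeros R (deriv w). [:-z, 1:] ^ nat (zorder (deriv w) z))"

definition CVD_neighborhood ::
  "nat \<Rightarrow> real \<Rightarrow> real \<Rightarrow> nat \<Rightarrow> (complex \<Rightarrow> complex) \<Rightarrow> (complex \<Rightarrow> complex) set \<Rightarrow> bool" where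
  "CVD_neighborhood \<rho> p R m w0 U \<longleftrightarrow>
     openin (E_topology \<rho> p) U \<and> w0 \<in> U \<and>
     (\<forall>w\<in>U. has_disc_zeros R m (deriv w)) \<and>
     (\<forall>k<m. tvs_holomorphic_on scale_fun (E_topology \<rho> p) U (\<lambda>w. coeff (crit_poly R w) k)) \<and>
     (\<exists>\<Phi>. tvs_holomorphic_on scale_fun_pair (prod_topology (E_topology \<rho> p) euclidean)
              (U \<times> ball 0 R) (\<lambda>(w, z). \<Phi> w z) \<and>
          (\<forall>w\<in>U. \<forall>z\<in>ball 0 R.
              \<Phi> w z \<noteq> 0 \<and> deriv w z = poly (crit_poly R w) z * \<Phi> w z))"

definition companion :: "nat \<Rightarrow> complex poly \<Rightarrow> complex mat" where
  "companion m q = Matrix.mat m m (\<lambda>(i, j).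
     if j = m - 1 then - coeff q i else if i = j + 1 then 1 else 0)"

(* The matrix-valued contour integral W(C) is taken entrywise; the inverse exists at every
   point of the contour, so the value of "the" on None plays no role. *)
definition W_matrix :: "real \<Rightarrow> nat \<Rightarrow> (complex \<Rightarrow> complex) \<Rightarrow> complex mat" where
  "W_matrix R m w = Matrix.mat m m (\<lambda>(i, j).
     - (1 / (2 * of_real pi * \<i>)) * contour_integral (circlepath 0 R)
         (\<lambda>\<zeta>. w \<zeta> *
            (the (mat_inverse (companion m (crit_poly R w) - \<zeta> \<cdot>\<^sub>m 1\<^sub>m m)) $$ (i, j))))"

(* The polynomial det (A - x I) in x; it differs from char_poly A by the factor (-1)^m. *)
definition det_poly :: "nat \<Rightarrow> complex mat \<Rightarrow> complex poly" where
  "det_poly m A = Determinant.det (map_mat (\<lambda>a. [:a:]) A - [:0, 1:] \<cdot>\<^sub>m 1\<^sub>m m)"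

definition discriminant :: "complex poly \<Rightarrow> complex" where
  "discriminant q = (-1) ^ (degree q * (degree q - 1) div 2) *
     resultant q (pderiv q) / lead_coeff q"

definition CVD :: "real \<Rightarrow> nat \<Rightarrow> (complex \<Rightarrow> complex) \<Rightarrow> complex" where
  "CVD R m w = (if m = 0 then 1 else discriminant (det_poly m (W_matrix R m w)))"

end

theory Submission
  imports Defs "Jordan_Normal_Form.Char_Poly"
begin

text \<open>
  By Cramer's rule each entry of W(C)(w) is the integral over the circle of a product of w(z), a
  cofactor of C(w) - z I, and the inverse of det (C(w) - z I). The last factor is defined because
  det (C(w) - z I) is, up to sign, the value at z of P_m(w, -), whose zeros lie in the open disc.
  The integrand belongs to the ring of functions of (w, z) that are continuous in w uniformly in z
  on the circle and whose difference quotients along every complex line in w converge uniformly in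
  z; integration over the circle turns such functions into holomorphic ones. The discriminant is a
  polynomial in the entries of W(C)(w), because the leading coefficient of det (W(C)(w) - x I) is
  the constant (-1)^m.
\<close>

section \<open>Rings of functions and determinants\<close>

text \<open>Subrings of functions that contain the constants, hence every polynomial expression in
  their members. The instances are the functionals holomorphic on \<open>U\<close>, the integrands
  over the circle, and families of polynomials taken coefficientwise.\<close>

locale function_ring =
  fixes P :: "('a \<Rightarrow> 'b::comm_ring_1) \<Rightarrow> bool"
  assumes const: "P (\<lambda>_. c)"
    and add: "P f \<Longrightarrow> P g \<Longrightarrow> P (\<lambda>x. f x + g x)"
    and mult: "P f \<Longrightarrow> P g \<Longrightarrow> P (\<lambda>x. f x * g x)"
begin

lemma uminus: "P f \<Longrightarrow> P (\<lambda>x. - f x)"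
  using mult[OF const[of "-1"], of f] by simp

lemma diff: "P f \<Longrightarrow> P g \<Longrightarrow> P (\<lambda>x. f x - g x)"
  using add[OF _ uminus, of f g] by simp

text \<open>The condition \<open>b\<close> does not depend on the argument of the functions; below
  it compares matrix indices.\<close>

lemma cond: "(b \<Longrightarrow> P f) \<Longrightarrow> (\<not> b \<Longrightarrow> P g) \<Longrightarrow> P (\<lambda>x. if b then f x else g x)"
  by (cases b) auto

lemma sum: "(\<And>i. i \<in> I \<Longrightarrow> P (f i)) \<Longrightarrow> P (\<lambda>x. \<Sum>i\<in>I. f i x)"
  by (induction I rule: infinite_finite_induct) (simp_all add: const add)

lemma prod: "(\<And>i. i \<in> I \<Longrightarrow> P (f i)) \<Longrightarrow> P (\<lambda>x. \<Prod>i\<in>I. f i x)"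
  by (induction I rule: infinite_finite_induct) (simp_all add: const mult)

text \<open>By the Leibniz formula a determinant is a polynomial in the entries.\<close>

lemma det:
  assumes "\<And>x. M x \<in> carrier_mat n n"
    and "\<And>i j. i < n \<Longrightarrow> j < n \<Longrightarrow> P (\<lambda>x. M x $$ (i, j))"
  shows "P (\<lambda>x. Determinant.det (M x))"
proof -
  have "P (\<lambda>x. signof q * (\<Prod>i = 0..<n. M x $$ (i, q i)))" if "q permutes {0..<n}" for q
    using permutes_in_image[OF that] by (intro mult const prod assms(2)) auto
  then show ?thesis
    unfolding det_def'[OF assms(1)] by (intro sum) simp
qed

lemma cofactor:
  assumes M: "\<And>x. M x \<in> carrier_mat n n"
    and P: "\<And>i j. i < n \<Longrightarrow> j < n \<Longrightarrow> P (\<lambda>x. M x $$ (i, j))"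
    and "i < n" "j < n"
  shows "P (\<lambda>x. cofactor (M x) i j)"
  unfolding cofactor_def
proof (intro mult const det)
  show "mat_delete (M x) i j \<in> carrier_mat (n - 1) (n - 1)" for x
    by (rule mat_delete_carrier[OF M])
  show "P (\<lambda>x. mat_delete (M x) i j $$ (i', j'))" if "i' < n - 1" "j' < n - 1" for i' j'
  proof -
    have "mat_delete (M x) i j $$ (i', j') =
        M x $$ (if i' < i then i' else Suc i', if j' < j then j' else Suc j')" for x
      using that M[of x] by (simp add: mat_delete_def)
    then show ?thesis
      using that by (auto intro!: P)
  qed
qed

text \<open>Coefficients of a product are finite convolution sums. This makes \<open>det\<close>
  applicable to matrices with polynomial entries, such as A - x I.\<close>

lemma coefficientwise: "function_ring (\<lambda>q. \<forall>k. P (\<lambda>x. poly.coeff (q x) k))"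
  by unfold_locales (auto simp: coeff_mult intro!: const add mult sum)

end

section \<open>The polynomial det (A - x I) and its discriminant\<close>

lemma det_poly_char_poly:
  assumes "A \<in> carrier_mat m m"
  shows "det_poly m A = (-1) ^ m * char_poly A"
proof -
  have "map_mat (\<lambda>a. [:a:]) A - [:0, 1:] \<cdot>\<^sub>m 1\<^sub>m m = (-1) \<cdot>\<^sub>m char_poly_matrix A"
    using assms by (intro eq_matI) (auto simp: char_poly_matrix_def)
  moreover have "dim_col (char_poly_matrix A) = m"
    using assms by (simp add: char_poly_matrix_def)
  ultimately show ?thesis
    by (simp add: det_poly_def char_poly_def det_smult)
qed

lemma degree_det_poly:
  assumes "A \<in> carrier_mat m m"
  shows "degree (det_poly m A) = m" and "lead_coeff (det_poly m A) = (-1) ^ m"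
proof -
  have "(-1) ^ m * char_poly A = Polynomial.smult ((-1) ^ m) (char_poly A)"
    by (induction m) simp_all
  then show "degree (det_poly m A) = m" "lead_coeff (det_poly m A) = (-1) ^ m"
    using degree_monic_char_poly[OF assms] by (auto simp: det_poly_char_poly[OF assms])
qed

text \<open>The degree is always \<open>m\<close>, so the Sylvester matrix has a fixed size, and the
  leading coefficient is the constant (-1)^m, so the division in \<open>discriminant\<close> is
  multiplication by a constant.\<close>

lemma function_ring_discriminant_det_poly:
  assumes "function_ring P"
    and M: "\<And>x. M x \<in> carrier_mat m m"
    and entries: "\<And>i j. i < m \<Longrightarrow> j < m \<Longrightarrow> P (\<lambda>x. M x $$ (i, j))"
  shows "P (\<lambda>x. discriminant (det_poly m (M x)))"
proof -
  interpret function_ring P by fact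
  interpret poly: function_ring "\<lambda>q. \<forall>k. P (\<lambda>x. poly.coeff (q x) k)"
    by (rule coefficientwise)
  let ?q = "\<lambda>x. det_poly m (M x)"
  have coeffs: "\<forall>k. P (\<lambda>x. poly.coeff (?q x) k)"
    unfolding det_poly_def
  proof (rule poly.det)
    show "map_mat (\<lambda>a. [:a:]) (M x) - [:0, 1:] \<cdot>\<^sub>m 1\<^sub>m m \<in> carrier_mat m m" for x
      by (intro minus_carrier_mat smult_carrier_mat one_carrier_mat)
    show "\<forall>k. P (\<lambda>x. poly.coeff ((map_mat (\<lambda>a. [:a:]) (M x) - [:0, 1:] \<cdot>\<^sub>m 1\<^sub>m m) $$ (i, j)) k)"
      if "i < m" "j < m" for i j
    proof
      fix k
      have "(map_mat (\<lambda>a. [:a:]) (M x) - [:0, 1:] \<cdot>\<^sub>m 1\<^sub>m m) $$ (i, j) =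
          [:M x $$ (i, j):] - (if i = j then [:0, 1:] else 0)" for x
        using that M[of x] by (simp add: one_pCons)
      then show "P (\<lambda>x. poly.coeff ((map_mat (\<lambda>a. [:a:]) (M x) - [:0, 1:] \<cdot>\<^sub>m 1\<^sub>m m) $$ (i, j)) k)"
        using entries[OF that] by (cases k) (auto intro!: diff const)
    qed
  qed
  have deg: "degree (?q x) = m" and lead: "poly.coeff (?q x) m = (-1) ^ m" for x
    using degree_det_poly[OF M[of x]] by simp_all
  have "P (\<lambda>x. resultant (?q x) (pderiv (?q x)))"
    unfolding resultant_def
  proof (rule det)
    show "sylvester_mat (?q x) (pderiv (?q x)) \<in> carrier_mat (m + (m - 1)) (m + (m - 1))" for x
      using sylvester_carrier_mat[of "?q x" "pderiv (?q x)"] by (simp add: degree_pderiv deg)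
    show "P (\<lambda>x. sylvester_mat (?q x) (pderiv (?q x)) $$ (i, j))"
      if "i < m + (m - 1)" "j < m + (m - 1)" for i j
    proof -
      \<comment> \<open>The first \<open>m - 1\<close> rows carry shifted coefficients of
        \<open>?q x\<close>, the other \<open>m\<close> rows those of its derivative. The case
        conditions involve the indices only.\<close>
      have "sylvester_mat (?q x) (pderiv (?q x)) $$ (i, j) =
          (if i < m - 1 then if i \<le> j \<and> j - i \<le> m then poly.coeff (?q x) (m + i - j) else 0
           else if i - (m - 1) \<le> j \<and> j \<le> i
             then of_nat (Suc (i - j)) * poly.coeff (?q x) (Suc (i - j)) else 0)" for x
        using sylvester_index_mat[of i "?q x" "pderiv (?q x)" j] that
        by (simp add: degree_pderiv deg coeff_pderiv del: of_nat_Suc)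
      then show ?thesis
        by (simp only:) (intro cond mult const coeffs[rule_format])
    qed
  qed
  then have "P (\<lambda>x. (-1) ^ (m * (m - 1) div 2) * resultant (?q x) (pderiv (?q x)) * (1 / (-1) ^ m))"
    by (intro mult const)
  then show ?thesis
    by (simp add: discriminant_def deg lead)
qed

section \<open>The companion matrix\<close>

text \<open>Cramer's rule, from multiplying A adj(A) = det(A) I by the inverse on the left. Since
  the determinant is nonzero, \<open>mat_inverse\<close> returns \<open>Some\<close>, and
  \<open>the\<close> extracts a genuine inverse.\<close>

lemma the_mat_inverse_entry:
  fixes A :: "'a::field mat"
  assumes A: "A \<in> carrier_mat n n" and det: "Determinant.det A \<noteq> 0" and ij: "i < n" "j < n"
  shows "the (mat_inverse A) $$ (i, j) = cofactor A j i * inverse (Determinant.det A)"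
proof -
  have "A \<in> Units (ring_mat TYPE('a) n ())"
    using det_non_zero_imp_unit[OF A det] .
  then obtain B where "mat_inverse A = Some B"
    using mat_inverse(1)[OF A, where b = "()"] by fastforce
  with mat_inverse(2)[OF A] have B: "the (mat_inverse A) = B" "B * A = 1\<^sub>m n" "B \<in> carrier_mat n n"
    by auto
  have "adj_mat A = (B * A) * adj_mat A"
    using B adj_mat(1)[OF A] by simp
  also have "\<dots> = B * (A * adj_mat A)"
    by (rule assoc_mult_mat[OF B(3) A adj_mat(1)[OF A]])
  also have "\<dots> = Determinant.det A \<cdot>\<^sub>m B"
    using B unfolding adj_mat(2)[OF A]
    by (metis mult_smult_distrib one_carrier_mat right_mult_one_mat)
  finally have "adj_mat A $$ (i, j) = Determinant.det A * B $$ (i, j)"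
    using B ij by simp
  then show ?thesis
    using ij A det B by (simp add: adj_mat_def field_simps)
qed

lemma companion_carrier [simp]: "companion m q \<in> carrier_mat m m"
  by (simp add: companion_def)

text \<open>
  A left null vector of the matrix is a multiple of (1, z, ..., z^(m-1)), and its last column then
  gives q(z) = 0.
\<close>

lemma det_companion_nonzero:
  assumes deg: "degree q = m" and monic: "lead_coeff q = 1" and root: "poly q z \<noteq> 0"
  shows "Determinant.det (companion m q - z \<cdot>\<^sub>m 1\<^sub>m m) \<noteq> 0"
proof
  let ?A = "companion m q - z \<cdot>\<^sub>m 1\<^sub>m m"
  have A: "?A \<in> carrier_mat m m"
    by (intro minus_carrier_mat smult_carrier_mat one_carrier_mat)
  assume "Determinant.det ?A = 0"
  \<comment> \<open>A singular matrix has a right null vector; transposing turns it into the desired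
    left one.\<close>
  then have "Determinant.det (transpose_mat ?A) = 0"
    by (simp add: det_transpose[OF A])
  then obtain v where v: "v \<in> carrier_vec m" "v \<noteq> 0\<^sub>v m" "transpose_mat ?A *\<^sub>v v = 0\<^sub>v m"
    using det_0_iff_vec_prod_zero[of "transpose_mat ?A" m] A by auto
  have dims: "dim_row (companion m q) = m" "dim_col (companion m q) = m"
    by (simp_all add: companion_def)
  have col: "(\<Sum>i<m. companion m q $$ (i, j) * v $ i) = z * v $ j" if "j < m" for j
  proof -
    have "0 = (transpose_mat ?A *\<^sub>v v) $ j"
      using v that by simp
    also have "\<dots> = (\<Sum>i<m. (companion m q $$ (i, j) - z * (if i = j then 1 else 0)) * v $ i)"
      using that v(1) by (auto simp: scalar_prod_def dims atLeast0LessThan intro!: sum.cong)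
    also have "\<dots> = (\<Sum>i<m. companion m q $$ (i, j) * v $ i) - (\<Sum>i<m. if i = j then z * v $ i else 0)"
      unfolding sum_subtractf[symmetric] by (intro sum.cong) (auto simp: algebra_simps)
    also have "(\<Sum>i<m. if i = j then z * v $ i else 0) = z * v $ j"
      using that by simp
    finally show ?thesis by simp
  qed
  \<comment> \<open>Every column but the last has its only nonzero entry, a 1, just below the
    diagonal.\<close>
  have step: "v $ Suc j = z * v $ j" if "Suc j < m" for j
  proof -
    have "z * v $ j = (\<Sum>i<m. companion m q $$ (i, j) * v $ i)"
      using col[of j] that by simp
    also have "\<dots> = (\<Sum>i<m. if i = Suc j then v $ i else 0)"
      using that by (intro sum.cong) (auto simp: companion_def)
    also have "\<dots> = v $ Suc j"
      using that by simp
    finally show ?thesis by simp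
  qed
  have pow: "v $ j = z ^ j * v $ 0" if "j < m" for j
    using that by (induction j) (simp_all add: step)
  \<comment> \<open>In dimension 0 every vector is the zero vector. Thus the last column, with index
    \<open>m - 1\<close>, exists.\<close>
  have "m \<noteq> 0"
    using v by (auto intro!: eq_vecI)
  have "z * v $ (m - 1) = (\<Sum>i<m. companion m q $$ (i, m - 1) * v $ i)"
    using col[of "m - 1"] \<open>m \<noteq> 0\<close> by simp
  also have "\<dots> = (\<Sum>i<m. - (poly.coeff q i * z ^ i) * v $ 0)"
  proof (intro sum.cong refl)
    fix i assume "i \<in> {..<m}"
    then have "i < m" by simp
    then show "companion m q $$ (i, m - 1) * v $ i = - (poly.coeff q i * z ^ i) * v $ 0"
      using pow[OF \<open>i < m\<close>] by (simp add: companion_def)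
  qed
  also have "\<dots> = - (\<Sum>i<m. poly.coeff q i * z ^ i) * v $ 0"
    by (simp add: sum_distrib_right sum_negf)
  finally have "(z * z ^ (m - 1) + (\<Sum>i<m. poly.coeff q i * z ^ i)) * v $ 0 = 0"
    using pow[of "m - 1"] \<open>m \<noteq> 0\<close> by (simp add: algebra_simps)
  moreover have "z * z ^ (m - 1) + (\<Sum>i<m. poly.coeff q i * z ^ i) = poly q z"
    using \<open>m \<noteq> 0\<close> monic deg
    by (cases m) (simp_all add: poly_altdef lessThan_Suc_atMost[symmetric])
  ultimately have "v $ 0 = 0"
    using root by simp
  then have "v $ j = 0" if "j < m" for j
    using pow[OF that] by simp
  then have "v = 0\<^sub>v m"
    using v(1) by (intro eq_vecI) auto
  with v show False by simp
qed

section \<open>The monic polynomial whose zeros are the critical points in the disc\<close>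

lemma crit_poly_monic: "lead_coeff (crit_poly R w) = 1"
  by (simp add: crit_poly_def lead_coeff_prod lead_coeff_power)

lemma degree_crit_poly:
  assumes "has_disc_zeros R m (deriv w)"
  shows "degree (crit_poly R w) = m"
  using assms by (simp add: crit_poly_def has_disc_zeros_def degree_prod_eq_sum_degree
      degree_linear_power)

lemma poly_crit_poly_nonzero:
  assumes "z \<notin> ball 0 R"
  shows "poly (crit_poly R w) z \<noteq> 0"
proof (cases "finite (disc_zeros R (deriv w))")
  case True
  with assms show ?thesis
    by (auto simp: crit_poly_def poly_prod disc_zeros_def)
\<comment> \<open>A product over an infinite set has the default value 1.\<close>
qed (simp add: crit_poly_def)

section \<open>Uniform convergence\<close>

lemma uniform_limit_of_tendsto:
  "(q \<longlongrightarrow> L) F \<Longrightarrow> uniform_limit T (\<lambda>x _. q x) (\<lambda>_. L) F"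
  unfolding uniform_limit_iff tendsto_iff by (auto elim: eventually_mono)

lemma compact_continuous_bounded_image:
  fixes f :: "'a::topological_space \<Rightarrow> 'b::metric_space"
  shows "compact T \<Longrightarrow> continuous_on T f \<Longrightarrow> bounded (f ` T)"
  by (simp add: compact_continuous_image compact_imp_bounded)

text \<open>Uniform convergence of products requires bounded limits; continuity on the compact set
  \<open>T\<close> supplies the bounds.\<close>

lemma uniform_limit_mult_compact:
  fixes l m :: "'b::topological_space \<Rightarrow> 'c::real_normed_algebra"
  assumes "compact T" "continuous_on T l" "continuous_on T m"
    and "uniform_limit T f l F" "uniform_limit T g m F"
  shows "uniform_limit T (\<lambda>x y. f x y * g x y) (\<lambda>y. l y * m y) F"
  using assms by (intro uniform_lim_mult compact_continuous_bounded_image)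

text \<open>On the compact set \<open>T\<close> the modulus of \<open>l\<close> attains a positive
  minimum, so the limit stays away from 0.\<close>

lemma uniform_limit_inverse_compact:
  fixes l :: "'b::topological_space \<Rightarrow> 'c::real_normed_field"
  assumes "compact T" "continuous_on T l" "\<And>y. y \<in> T \<Longrightarrow> l y \<noteq> 0"
    and "uniform_limit T f l F"
  shows "uniform_limit T (\<lambda>x y. inverse (f x y)) (\<lambda>y. inverse (l y)) F"
proof (cases "T = {}")
  case False
  then obtain y0 where y0: "y0 \<in> T" "\<And>y. y \<in> T \<Longrightarrow> norm (l y0) \<le> norm (l y)"
    using continuous_attains_inf[of T "\<lambda>y. norm (l y)"] assms(1,2)
    by (auto intro: continuous_on_norm)
  then show ?thesis
    using uniform_lim_inverse[OF assms(4), of "norm (l y0)"] assms(3) by (auto simp: o_def)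
qed simp

text \<open>
  The limits are taken within S, so that S need not be open: the slices of U by complex lines can
  be used without knowing that the vector operations are continuous.
\<close>

definition unif_diff_on ::
  "complex set \<Rightarrow> complex set \<Rightarrow> (complex \<Rightarrow> complex \<Rightarrow> complex) \<Rightarrow> bool" where
  "unif_diff_on S T g \<longleftrightarrow> (\<forall>c\<in>S. continuous_on T (g c)) \<and>
     (\<forall>c\<in>S. \<exists>g'. continuous_on T g' \<and>
        uniform_limit T (\<lambda>x y. (g x y - g c y) / (x - c)) g' (at c within S))"

section \<open>Closure properties of uniform differentiability\<close>

lemma unif_diff_onE:
  assumes "unif_diff_on S T g" "c \<in> S"
  obtains g' where "continuous_on T g'"
    "uniform_limit T (\<lambda>x y. (g x y - g c y) / (x - c)) g' (at c within S)"
  using assms unfolding unif_diff_on_def by blast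

text \<open>As for ordinary derivatives: \<open>g x\<close> is \<open>g c\<close> plus
  \<open>x - c\<close> times the difference quotient, and the quotient has a bounded limit.\<close>

lemma unif_diff_on_imp_uniform_limit:
  assumes "compact T" "unif_diff_on S T g" "c \<in> S"
  shows "uniform_limit T g (g c) (at c within S)"
proof -
  obtain g' where g': "continuous_on T g'"
    "uniform_limit T (\<lambda>x y. (g x y - g c y) / (x - c)) g' (at c within S)"
    using unif_diff_onE[OF assms(2,3)] .
  have "uniform_limit T (\<lambda>x _. x - c) (\<lambda>_. c - c) (at c within S)"
    by (intro uniform_limit_of_tendsto tendsto_intros)
  then have "uniform_limit T (\<lambda>x y. (x - c) * ((g x y - g c y) / (x - c)) + g c y)
      (\<lambda>y. (c - c) * g' y + g c y) (at c within S)"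
    using g' assms(1) by (intro uniform_limit_add uniform_limit_mult_compact uniform_limit_const) auto
  moreover have "\<forall>\<^sub>F x in at c within S. \<forall>y\<in>T. (x - c) * ((g x y - g c y) / (x - c)) + g c y = g x y"
    by (auto simp: eventually_at_filter)
  ultimately show ?thesis
    using uniform_limit_cong[of T "\<lambda>x y. (x - c) * ((g x y - g c y) / (x - c)) + g c y" g]
    by simp
qed

lemma unif_diff_on_of_holomorphic:
  assumes "f holomorphic_on S"
  shows "unif_diff_on S T (\<lambda>x _. f x)"
  unfolding unif_diff_on_def
proof (intro conjI ballI)
  fix c assume "c \<in> S"
  then obtain D where "(f has_field_derivative D) (at c within S)"
    using assms by (auto simp: holomorphic_on_def field_differentiable_def)
  then have "uniform_limit T (\<lambda>x _. (f x - f c) / (x - c)) (\<lambda>_. D) (at c within S)"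
    by (intro uniform_limit_of_tendsto) (simp add: has_field_derivative_iff)
  then show "\<exists>g'. continuous_on T g' \<and>
      uniform_limit T (\<lambda>x _. (f x - f c) / (x - c)) g' (at c within S)"
    by (intro exI[of _ "\<lambda>_. D"]) simp
qed simp

text \<open>The difference quotient equals \<open>h\<close> exactly. This covers evaluation along a
  complex line of functions and, with \<open>h\<close> zero, functions of the contour point
  alone.\<close>

lemma unif_diff_on_affine:
  assumes "continuous_on T f" "continuous_on T h"
  shows "unif_diff_on S T (\<lambda>x y. f y + x * h y)"
  unfolding unif_diff_on_def
proof (intro conjI ballI exI[of _ h])
  fix c
  show "continuous_on T (\<lambda>y. f y + c * h y)"
    by (intro continuous_intros assms)
  have "\<forall>\<^sub>F x in at c within S. \<forall>y\<in>T. h y = (f y + x * h y - (f y + c * h y)) / (x - c)"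
    by (auto simp: eventually_at_filter field_simps)
  then show "uniform_limit T (\<lambda>x y. (f y + x * h y - (f y + c * h y)) / (x - c)) h (at c within S)"
    using uniform_limit_cong[of T "\<lambda>_. h" "\<lambda>x y. (f y + x * h y - (f y + c * h y)) / (x - c)"
        "at c within S" h h] uniform_limit_const by blast
qed (rule assms)

lemma unif_diff_on_add:
  assumes "unif_diff_on S T f" "unif_diff_on S T g"
  shows "unif_diff_on S T (\<lambda>x y. f x y + g x y)"
  unfolding unif_diff_on_def
proof (intro conjI ballI)
  fix c assume c: "c \<in> S"
  show "continuous_on T (\<lambda>y. f c y + g c y)"
    using assms c by (auto simp: unif_diff_on_def intro: continuous_intros)
  obtain f' where f': "continuous_on T f'"
    "uniform_limit T (\<lambda>x y. (f x y - f c y) / (x - c)) f' (at c within S)"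
    using unif_diff_onE[OF assms(1) c] .
  obtain g' where g': "continuous_on T g'"
    "uniform_limit T (\<lambda>x y. (g x y - g c y) / (x - c)) g' (at c within S)"
    using unif_diff_onE[OF assms(2) c] .
  have "(f x y + g x y - (f c y + g c y)) / (x - c) =
      (f x y - f c y) / (x - c) + (g x y - g c y) / (x - c)" for x y
    by (simp add: diff_divide_distrib add_divide_distrib)
  then have "uniform_limit T (\<lambda>x y. (f x y + g x y - (f c y + g c y)) / (x - c))
      (\<lambda>y. f' y + g' y) (at c within S)"
    using uniform_limit_add[OF f'(2) g'(2)] by simp
  then show "\<exists>h. continuous_on T h \<and>
      uniform_limit T (\<lambda>x y. (f x y + g x y - (f c y + g c y)) / (x - c)) h (at c within S)"
    using continuous_on_add[OF f'(1) g'(1)] by blast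
qed

lemma unif_diff_on_mult:
  assumes T: "compact T" and "unif_diff_on S T f" "unif_diff_on S T g"
  shows "unif_diff_on S T (\<lambda>x y. f x y * g x y)"
  unfolding unif_diff_on_def
proof (intro conjI ballI)
  fix c assume c: "c \<in> S"
  have cont: "continuous_on T (f c)" "continuous_on T (g c)"
    using assms c by (auto simp: unif_diff_on_def)
  then show "continuous_on T (\<lambda>y. f c y * g c y)"
    by (intro continuous_intros)
  obtain f' where f': "continuous_on T f'"
    "uniform_limit T (\<lambda>x y. (f x y - f c y) / (x - c)) f' (at c within S)"
    using unif_diff_onE[OF assms(2) c] .
  obtain g' where g': "continuous_on T g'"
    "uniform_limit T (\<lambda>x y. (g x y - g c y) / (x - c)) g' (at c within S)"
    using unif_diff_onE[OF assms(3) c] .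
  \<comment> \<open>Product rule: the quotient of \<open>f\<close> is multiplied by
    \<open>g x\<close>, not \<open>g c\<close>, so the uniform convergence of \<open>g x\<close> to
    \<open>g c\<close> enters.\<close>
  have eq: "(f x y * g x y - f c y * g c y) / (x - c) =
      (f x y - f c y) / (x - c) * g x y + f c y * ((g x y - g c y) / (x - c))" for x y
    by (simp add: algebra_simps diff_divide_distrib)
  have "uniform_limit T (\<lambda>x y. (f x y - f c y) / (x - c) * g x y + f c y * ((g x y - g c y) / (x - c)))
      (\<lambda>y. f' y * g c y + f c y * g' y) (at c within S)"
    by (intro uniform_limit_add uniform_limit_mult_compact uniform_limit_const T cont f' g'
        unif_diff_on_imp_uniform_limit[OF T assms(3) c])
  moreover have "continuous_on T (\<lambda>y. f' y * g c y + f c y * g' y)"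
    by (intro continuous_intros cont f' g')
  ultimately show "\<exists>h. continuous_on T h \<and>
      uniform_limit T (\<lambda>x y. (f x y * g x y - f c y * g c y) / (x - c)) h (at c within S)"
    unfolding eq by blast
qed

lemma unif_diff_on_inverse:
  assumes T: "compact T" and g: "unif_diff_on S T g"
    and nz: "\<And>x y. x \<in> S \<Longrightarrow> y \<in> T \<Longrightarrow> g x y \<noteq> 0"
  shows "unif_diff_on S T (\<lambda>x y. inverse (g x y))"
  unfolding unif_diff_on_def
proof (intro conjI ballI)
  fix c assume c: "c \<in> S"
  have cont: "continuous_on T (g c)"
    using g c by (auto simp: unif_diff_on_def)
  show contI: "continuous_on T (\<lambda>y. inverse (g c y))"
    using nz c by (intro continuous_intros cont) auto
  obtain g' where g': "continuous_on T g'"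
    "uniform_limit T (\<lambda>x y. (g x y - g c y) / (x - c)) g' (at c within S)"
    using unif_diff_onE[OF g c] .
  have "uniform_limit T (\<lambda>x y. inverse (g x y)) (\<lambda>y. inverse (g c y)) (at c within S)"
    using nz c by (intro uniform_limit_inverse_compact T cont
        unif_diff_on_imp_uniform_limit[OF T g c]) auto
  then have "uniform_limit T
      (\<lambda>x y. - ((g x y - g c y) / (x - c) * (inverse (g x y) * inverse (g c y))))
      (\<lambda>y. - (g' y * (inverse (g c y) * inverse (g c y)))) (at c within S)"
    by (intro uniform_limit_uminus uniform_limit_mult_compact uniform_limit_const T contI g'
        continuous_intros)
  \<comment> \<open>The identity needs \<open>g x y\<close> to be nonzero, which holds for
    \<open>x\<close> in \<open>S\<close>, hence eventually.\<close>
  moreover have "\<forall>\<^sub>F x in at c within S. \<forall>y\<in>T.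
      - ((g x y - g c y) / (x - c) * (inverse (g x y) * inverse (g c y))) =
      (inverse (g x y) - inverse (g c y)) / (x - c)"
    using nz c by (auto simp: eventually_at_filter field_simps)
  ultimately have "uniform_limit T (\<lambda>x y. (inverse (g x y) - inverse (g c y)) / (x - c))
      (\<lambda>y. - (g' y * (inverse (g c y) * inverse (g c y)))) (at c within S)"
    using uniform_limit_cong[of T
        "\<lambda>x y. - ((g x y - g c y) / (x - c) * (inverse (g x y) * inverse (g c y)))"
        "\<lambda>x y. (inverse (g x y) - inverse (g c y)) / (x - c)"] by simp
  moreover have "continuous_on T (\<lambda>y. - (g' y * (inverse (g c y) * inverse (g c y))))"
    by (intro continuous_intros contI g')
  ultimately show "\<exists>h. continuous_on T h \<and>
      uniform_limit T (\<lambda>x y. (inverse (g x y) - inverse (g c y)) / (x - c)) h (at c within S)"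
    by blast
qed

text \<open>Uniform convergence on the circle lets the limit of the difference quotients pass under
  the integral; the derivative is the integral of \<open>g'\<close>.\<close>

lemma holomorphic_on_contour_integral_circlepath:
  assumes g: "unif_diff_on S (sphere z r) g" and "r > 0"
  shows "(\<lambda>c. contour_integral (circlepath z r) (g c)) holomorphic_on S"
  unfolding holomorphic_on_def
proof
  fix c assume c: "c \<in> S"
  let ?I = "contour_integral (circlepath z r)"
  let ?q = "\<lambda>x y. (g x y - g c y) / (x - c)"
  have int: "g x contour_integrable_on circlepath z r" if "x \<in> S" for x
    using g that \<open>r > 0\<close>
    by (auto simp: unif_diff_on_def intro!: contour_integrable_continuous_circlepath)
  obtain g' where g': "uniform_limit (sphere z r) ?q g' (at c within S)"
    using g c unfolding unif_diff_on_def by blast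
  have inS: "\<forall>\<^sub>F x in at c within S. x \<in> S"
    by (simp add: eventually_at_filter)
  have "((\<lambda>x. (?I (g x) - ?I (g c)) / (x - c)) \<longlongrightarrow> ?I g') (at c within S)"
  \<comment> \<open>If \<open>c\<close> is isolated in \<open>S\<close>, the filter is trivial and
    every limit holds.\<close>
  proof (cases "at c within S = bot")
    case False
    have "\<forall>\<^sub>F x in at c within S. ?q x contour_integrable_on circlepath z r"
      using inS by eventually_elim
        (intro contour_integrable_div contour_integrable_diff int c)
    from contour_integral_uniform_limit_circlepath(2)[OF this g' False \<open>r > 0\<close>]
    have "((\<lambda>x. ?I (?q x)) \<longlongrightarrow> ?I g') (at c within S)" .
    moreover have "\<forall>\<^sub>F x in at c within S. ?I (?q x) = (?I (g x) - ?I (g c)) / (x - c)"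
      using inS by eventually_elim
        (simp add: contour_integral_div contour_integral_diff contour_integrable_diff int c)
    ultimately show ?thesis
      by (rule Lim_transform_eventually)
  qed simp
  then show "(\<lambda>c. ?I (g c)) field_differentiable at c within S"
    by (auto simp: field_differentiable_def has_field_derivative_iff)
qed

section \<open>Families of functions depending holomorphically on a vector\<close>

text \<open>Recasts continuity as convergence along \<open>atin\<close>, so that limit rules apply
  directly.\<close>

lemma tvs_holomorphic_on_iff:
  assumes "openin X U"
  shows "tvs_holomorphic_on s X U f \<longleftrightarrow>
    (\<forall>w\<in>U. (f \<longlongrightarrow> f w) (atin (subtopology X U) w)) \<and>
    (\<forall>u\<in>topspace X. \<forall>h\<in>topspace X. (\<lambda>c. f (u + s c h)) holomorphic_on {c. u + s c h \<in> U})"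
  using assms openin_subset[OF assms]
  by (auto simp: tvs_holomorphic_on_def continuous_map_atin)

text \<open>The subtopology and the slices see only values on \<open>U\<close>, so a formula valid
  on \<open>U\<close> alone, such as Cramer's rule, may be substituted.\<close>

lemma tvs_holomorphic_on_cong:
  assumes "\<And>w. w \<in> U \<Longrightarrow> f w = g w"
  shows "tvs_holomorphic_on s X U f \<longleftrightarrow> tvs_holomorphic_on s X U g"
proof -
  have "continuous_map (subtopology X U) euclidean f \<longleftrightarrow> continuous_map (subtopology X U) euclidean g"
    using continuous_map_eq[of "subtopology X U" euclidean f g]
      continuous_map_eq[of "subtopology X U" euclidean g f] assms by auto
  moreover have "(\<lambda>c. f (u + s c h)) holomorphic_on {c. u + s c h \<in> U} \<longleftrightarrow>
      (\<lambda>c. g (u + s c h)) holomorphic_on {c. u + s c h \<in> U}" for u h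
    using assms by (intro holomorphic_cong) auto
  ultimately show ?thesis
    by (simp add: tvs_holomorphic_on_def)
qed

lemma function_ring_tvs_holomorphic_on:
  assumes "openin X U"
  shows "function_ring (tvs_holomorphic_on s X U)"
  by unfold_locales
    (auto simp: tvs_holomorphic_on_iff[OF assms] intro!: tendsto_intros holomorphic_intros)

text \<open>The class of integrands. Vector and contour point form one pair, so that the predicate
  has the shape required by \<open>function_ring\<close>.\<close>

definition unif_holomorphic_on ::
  "(complex \<Rightarrow> 'v \<Rightarrow> 'v) \<Rightarrow> 'v topology \<Rightarrow> 'v set \<Rightarrow> complex set \<Rightarrow>
    ('v::ab_group_add \<times> complex \<Rightarrow> complex) \<Rightarrow> bool" where
  "unif_holomorphic_on s X U T f \<longleftrightarrow>
     (\<forall>w\<in>U. continuous_on T (\<lambda>y. f (w, y))) \<and>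
     (\<forall>w\<in>U. uniform_limit T (\<lambda>v y. f (v, y)) (\<lambda>y. f (w, y)) (atin (subtopology X U) w)) \<and>
     (\<forall>u\<in>topspace X. \<forall>h\<in>topspace X.
        unif_diff_on {c. u + s c h \<in> U} T (\<lambda>c y. f (u + s c h, y)))"

lemma function_ring_unif_holomorphic_on:
  assumes "compact T"
  shows "function_ring (unif_holomorphic_on s X U T)"
proof
  show "unif_holomorphic_on s X U T (\<lambda>_. c)" for c
    using unif_diff_on_of_holomorphic[of "\<lambda>_. c"]
    by (auto simp: unif_holomorphic_on_def intro: uniform_limit_const)
  fix f g assume fg: "unif_holomorphic_on s X U T f" "unif_holomorphic_on s X U T g"
  then show "unif_holomorphic_on s X U T (\<lambda>x. f x + g x)"
    by (auto simp: unif_holomorphic_on_def intro!: continuous_intros uniform_limit_add unif_diff_on_add)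
  show "unif_holomorphic_on s X U T (\<lambda>x. f x * g x)"
    using fg assms by (auto simp: unif_holomorphic_on_def
        intro!: continuous_intros uniform_limit_mult_compact unif_diff_on_mult)
qed

lemma unif_holomorphic_on_inverse:
  assumes "compact T" and "unif_holomorphic_on s X U T f"
    and "\<And>w y. w \<in> U \<Longrightarrow> y \<in> T \<Longrightarrow> f (w, y) \<noteq> 0"
  shows "unif_holomorphic_on s X U T (\<lambda>x. inverse (f x))"
  using assms by (auto simp: unif_holomorphic_on_def
      intro!: continuous_intros uniform_limit_inverse_compact unif_diff_on_inverse)

text \<open>Without dependence on the contour point, limits are automatically uniform. This admits
  the coefficients a_k(w) as integrands.\<close>

lemma unif_holomorphic_on_fst:
  assumes "tvs_holomorphic_on s X U f"
  shows "unif_holomorphic_on s X U T (\<lambda>x. f (fst x))"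
proof -
  have "openin X U"
    using assms by (simp add: tvs_holomorphic_on_def)
  with assms show ?thesis
    by (auto simp: unif_holomorphic_on_def tvs_holomorphic_on_iff
        intro!: uniform_limit_of_tendsto unif_diff_on_of_holomorphic)
qed

lemma unif_holomorphic_on_snd:
  assumes "continuous_on T f"
  shows "unif_holomorphic_on s X U T (\<lambda>x. f (snd x))"
  using assms unif_diff_on_affine[OF assms, of "\<lambda>_. 0"]
  by (auto simp: unif_holomorphic_on_def intro: uniform_limit_const)

text \<open>Uniform limits pass under the integral twice: once for continuity in the vector, once
  for the derivative along a complex line.\<close>

lemma tvs_holomorphic_on_contour_integral_circlepath:
  assumes X: "openin X U" and f: "unif_holomorphic_on s X U (sphere z r) f" and "r > 0"
  shows "tvs_holomorphic_on s X U (\<lambda>w. contour_integral (circlepath z r) (\<lambda>y. f (w, y)))"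
  unfolding tvs_holomorphic_on_iff[OF X]
proof (intro conjI ballI)
  fix w assume w: "w \<in> U"
  let ?F = "atin (subtopology X U) w"
  show "((\<lambda>w. contour_integral (circlepath z r) (\<lambda>y. f (w, y))) \<longlongrightarrow>
      contour_integral (circlepath z r) (\<lambda>y. f (w, y))) ?F"
  proof (cases "?F = bot")
    case False
    have "\<forall>\<^sub>F v in ?F. v \<in> U"
      using X w by (auto simp: eventually_atin openin_subtopology_refl openin_subset intro!: exI[of _ U])
    then have "\<forall>\<^sub>F v in ?F. (\<lambda>y. f (v, y)) contour_integrable_on circlepath z r"
      using f \<open>r > 0\<close> by (auto simp: unif_holomorphic_on_def elim!: eventually_mono
          intro!: contour_integrable_continuous_circlepath)
    then show ?thesis
      using f w False \<open>r > 0\<close> by (intro contour_integral_uniform_limit_circlepath(2))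
        (auto simp: unif_holomorphic_on_def)
  qed simp
next
  fix u h assume "u \<in> topspace X" "h \<in> topspace X"
  then show "(\<lambda>c. contour_integral (circlepath z r) (\<lambda>y. f (u + s c h, y)))
      holomorphic_on {c. u + s c h \<in> U}"
    using f \<open>r > 0\<close>
    by (intro holomorphic_on_contour_integral_circlepath) (auto simp: unif_holomorphic_on_def)
qed

section \<open>The space of entire functions\<close>

text \<open>Suprema over |z| \<ge> r decrease in r, so this identifies the \<open>Lim\<close> in
  \<open>E_space\<close>, a definite description, with an infimum.\<close>

lemma tendsto_INF_antimono:
  fixes F :: "real \<Rightarrow> ereal"
  assumes "antimono F"
  shows "(F \<longlongrightarrow> (INF r. F r)) at_top"
proof (rule order_tendstoI)
  fix a assume "a < (INF r. F r)"
  then show "\<forall>\<^sub>F x in at_top. a < F x"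
    by (intro always_eventually allI) (rule less_INF_D, auto)
next
  fix a assume "(INF r. F r) < a"
  then obtain r where "F r < a"
    by (auto simp: INF_less_iff)
  then have "F x < a" if "r \<le> x" for x
    using antimonoD[OF assms that] by simp
  then show "\<forall>\<^sub>F x in at_top. F x < a"
    using eventually_ge_at_top[of r] by (rule eventually_mono[rotated])
qed

text \<open>The infimum of the tail suprema lies below \<open>q\<close>, so some single tail
  supremum does.\<close>

lemma E_space_eventually_log_growth_less:
  assumes "f \<in> E_space \<rho> p" "p < q"
  obtains r where "\<And>z. r \<le> cmod z \<Longrightarrow> log_growth \<rho> f z < ereal q"
proof -
  define F where "F = (\<lambda>r::real. SUP z\<in>{z. r \<le> cmod z}. log_growth \<rho> f z)"
  have "antimono F"
    unfolding F_def antimono_def by (auto intro!: SUP_subset_mono)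
  then have "Lim at_top F = (INF r. F r)"
    by (intro tendsto_Lim tendsto_INF_antimono) simp_all
  with assms have "(INF r. F r) \<le> ereal p"
    by (simp add: E_space_def F_def)
  also have "\<dots> < ereal q"
    using assms by simp
  finally obtain r where "F r < ereal q"
    by (auto simp: INF_less_iff)
  then have "log_growth \<rho> f z < ereal q" if "r \<le> cmod z" for z
    using that by (auto simp: F_def elim: le_less_trans[rotated] intro: SUP_upper)
  with that show thesis by blast
qed

text \<open>A real supremum is meaningful only for bounded sets. Continuity bounds the weighted
  modulus on a closed disc, and the growth condition bounds it by 1 outside.\<close>

lemma E_space_bdd_above:
  assumes f: "f \<in> E_space \<rho> p" and "n \<ge> 1"
  shows "bdd_above (range (\<lambda>z. exp (- (p + 1 / real n) * cmod z ^ \<rho>) * cmod (f z)))"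
proof -
  let ?q = "p + 1 / real n"
  let ?G = "\<lambda>z. exp (- ?q * cmod z ^ \<rho>) * cmod (f z)"
  \<comment> \<open>For \<open>n \<ge> 1\<close> the summand \<open>1 / real n\<close> is positive,
    so \<open>?q\<close> exceeds \<open>p\<close> strictly.\<close>
  obtain r where r: "\<And>z. r \<le> cmod z \<Longrightarrow> log_growth \<rho> f z < ereal ?q"
    using E_space_eventually_log_growth_less[OF f, of ?q] \<open>n \<ge> 1\<close> by auto
  have "continuous_on UNIV f"
    using f by (auto simp: E_space_def intro: holomorphic_on_imp_continuous_on)
  \<comment> \<open>A radius of at least 1 keeps \<open>cmod z\<close> positive outside, as needed
    to clear the denominator in \<open>log_growth\<close>.\<close>
  then have "continuous_on (cball 0 (max r 1)) ?G"
    by (intro continuous_intros) (auto elim: continuous_on_subset)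
  then have "bdd_above (?G ` cball 0 (max r 1))"
    by (intro bounded_imp_bdd_above compact_continuous_bounded_image compact_cball)
  then obtain B where B: "\<And>z. z \<in> cball 0 (max r 1) \<Longrightarrow> ?G z \<le> B"
    unfolding bdd_above_def by blast
  have "?G z \<le> max B 1" for z
  proof (cases "z \<in> cball 0 (max r 1)")
    case True
    then show ?thesis using B by force
  next
    case False
    then have "r \<le> cmod z" "0 < cmod z"
      by auto
    then have z: "r \<le> cmod z" "0 < cmod z ^ \<rho>"
      by simp_all
    show ?thesis
    proof (cases "f z = 0")
      case nz: False
      have "ln (cmod (f z)) / cmod z ^ \<rho> < ?q"
        using r[OF z(1)] nz by (simp add: log_growth_def)
      then have "ln (cmod (f z)) < ?q * cmod z ^ \<rho>"
        using z(2) by (simp add: pos_divide_less_eq)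
      then have "cmod (f z) \<le> exp (?q * cmod z ^ \<rho>)"
        using nz by (metis exp_ln exp_less_mono less_imp_le zero_less_norm_iff)
      then have "?G z \<le> exp (- ?q * cmod z ^ \<rho>) * exp (?q * cmod z ^ \<rho>)"
        by (intro mult_left_mono) auto
      also have "\<dots> = 1"
        by (simp add: algebra_simps flip: exp_add)
      finally show ?thesis by simp
    qed simp
  qed
  then show ?thesis
    by (auto intro!: bdd_aboveI[where M = "max B 1"])
qed

text \<open>Undoing the weight turns the norm into a pointwise bound. The triangle inequality, with
  the bounds for \<open>f\<close> and \<open>g\<close>, makes the supremum in \<open>E_norm\<close>
  an actual upper bound.\<close>

lemma cmod_diff_le_E_norm:
  assumes "f \<in> E_space \<rho> p" "g \<in> E_space \<rho> p" "n \<ge> 1"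
  shows "cmod (g z - f z) \<le> exp ((p + 1 / real n) * cmod z ^ \<rho>) * E_norm \<rho> p n (\<lambda>z. g z - f z)"
proof -
  define q where "q = p + 1 / real n"
  let ?e = "\<lambda>z. exp (- q * cmod z ^ \<rho>)"
  obtain A B where AB: "\<And>z. ?e z * cmod (f z) \<le> A" "\<And>z. ?e z * cmod (g z) \<le> B"
    using E_space_bdd_above[OF assms(1,3)] E_space_bdd_above[OF assms(2,3)]
    unfolding bdd_above_def q_def by blast
  have "?e z * cmod (g z - f z) \<le> A + B" for z
  proof -
    have "?e z * cmod (g z - f z) \<le> ?e z * (cmod (g z) + cmod (f z))"
      by (intro mult_left_mono norm_triangle_ineq4) simp
    also have "\<dots> \<le> A + B"
      using AB[of z] by (simp add: distrib_left)
    finally show ?thesis .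
  qed
  then have "?e z * cmod (g z - f z) \<le> E_norm \<rho> p n (\<lambda>z. g z - f z)"
    unfolding E_norm_def q_def[symmetric] by (intro cSUP_upper bdd_aboveI[where M = "A + B"]) auto
  then have "exp (q * cmod z ^ \<rho>) * (?e z * cmod (g z - f z)) \<le>
      exp (q * cmod z ^ \<rho>) * E_norm \<rho> p n (\<lambda>z. g z - f z)"
    by (intro mult_left_mono) simp_all
  then show ?thesis
    by (simp add: q_def[symmetric] mult.assoc[symmetric] flip: exp_add)
qed

lemma topspace_E_topology_subset: "topspace (E_topology \<rho> p) \<subseteq> E_space \<rho> p"
  unfolding E_topology_def topology_generated_by_topspace by auto

lemma openin_E_ball:
  assumes "f \<in> E_space \<rho> p" "n \<ge> 1" "e > 0"
  shows "openin (E_topology \<rho> p) {g \<in> E_space \<rho> p. E_norm \<rho> p n (\<lambda>z. g z - f z) < e}"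
  unfolding E_topology_def using assms by (intro topology_generated_by_Basis) blast

text \<open>On the circle the weight is constant, so the norm with \<open>n = 1\<close> controls
  values uniformly; along a complex line evaluation is affine in the parameter.\<close>

lemma unif_holomorphic_on_eval:
  assumes U: "openin (E_topology \<rho> p) U"
  shows "unif_holomorphic_on scale_fun (E_topology \<rho> p) U (sphere 0 R) (\<lambda>(w, \<zeta>). w \<zeta>)"
proof -
  let ?X = "E_topology \<rho> p"
  have cont: "continuous_on (sphere 0 R) w" if "w \<in> E_space \<rho> p" for w
    using that by (auto simp: E_space_def dest!: holomorphic_on_imp_continuous_on
        elim: continuous_on_subset)
  have sub: "U \<subseteq> E_space \<rho> p"
    using openin_subset[OF U] topspace_E_topology_subset by blast
  have "uniform_limit (sphere 0 R) (\<lambda>v. v) w (atin (subtopology ?X U) w)" if w: "w \<in> U" for w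
  proof (rule uniform_limitI)
    fix e :: real assume "e > 0"
    \<comment> \<open>Divides \<open>e\<close> by the reciprocal weight at |z| = R for
      \<open>n = 1\<close>, so that a ball of radius \<open>d\<close> forces a deviation below
      \<open>e\<close>.\<close>
    define d where "d = e / exp ((p + 1) * R ^ \<rho>)"
    let ?V = "U \<inter> {g \<in> E_space \<rho> p. E_norm \<rho> p 1 (\<lambda>z. g z - w z) < d}"
    have "d > 0" using \<open>e > 0\<close> by (simp add: d_def)
    then have V: "openin (subtopology ?X U) ?V"
      using w sub by (intro openin_subtopology_Int2 openin_E_ball) auto
    have "E_norm \<rho> p 1 (\<lambda>z. w z - w z) = 0"
      by (simp add: E_norm_def)
    then have "w \<in> ?V"
      using w sub \<open>d > 0\<close> by auto
    moreover have "dist (v \<zeta>) (w \<zeta>) < e" if "v \<in> ?V" "\<zeta> \<in> sphere 0 R" for v \<zeta>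
    proof -
      have "cmod (v \<zeta> - w \<zeta>) \<le> exp ((p + 1) * R ^ \<rho>) * E_norm \<rho> p 1 (\<lambda>z. v z - w z)"
        using cmod_diff_le_E_norm[of w \<rho> p v 1 \<zeta>] that w sub by auto
      also have "\<dots> < exp ((p + 1) * R ^ \<rho>) * d"
        using that by simp
      finally show ?thesis by (simp add: d_def dist_norm)
    qed
    ultimately show "\<forall>\<^sub>F v in atin (subtopology ?X U) w. \<forall>\<zeta>\<in>sphere 0 R. dist (v \<zeta>) (w \<zeta>) < e"
      using V by (auto simp only: eventually_atin intro!: disjI2 exI[of _ ?V])
  qed
  moreover have "unif_diff_on S (sphere 0 R) (\<lambda>c y. (u + scale_fun c h) y)"
    if "u \<in> topspace ?X" "h \<in> topspace ?X" for S u h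
    using unif_diff_on_affine[of "sphere 0 R" u h S] cont that topspace_E_topology_subset[of \<rho> p]
    by (auto simp: plus_fun_apply scale_fun_def)
  ultimately show ?thesis
    using cont sub by (auto simp: unif_holomorphic_on_def)
qed

section \<open>Holomorphy of the entries of W(C) and of their discriminant\<close>

lemma tvs_holomorphic_on_W_matrix_entry:
  assumes "R > 0" and U: "openin (E_topology \<rho> p) U"
    and zeros: "\<And>w. w \<in> U \<Longrightarrow> has_disc_zeros R m (deriv w)"
    and coeffs: "\<And>k. k < m \<Longrightarrow>
      tvs_holomorphic_on scale_fun (E_topology \<rho> p) U (\<lambda>w. poly.coeff (crit_poly R w) k)"
    and ij: "i < m" "j < m"
  shows "tvs_holomorphic_on scale_fun (E_topology \<rho> p) U (\<lambda>w. W_matrix R m w $$ (i, j))"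
proof -
  let ?X = "E_topology \<rho> p" and ?T = "sphere 0 R :: complex set"
  let ?P = "unif_holomorphic_on scale_fun ?X U ?T"
  define A where "A = (\<lambda>(w, \<zeta>). companion m (crit_poly R w) - \<zeta> \<cdot>\<^sub>m 1\<^sub>m m)"
  \<comment> \<open>The integrand by Cramer's rule; the cofactor indices are swapped because the
    adjugate is transposed.\<close>
  define f where "f = (\<lambda>x. (case x of (w, \<zeta>) \<Rightarrow> w \<zeta>) *
      (cofactor (A x) j i * inverse (Determinant.det (A x))))"
  interpret function_ring ?P
    by (intro function_ring_unif_holomorphic_on compact_sphere)
  interpret H: function_ring "tvs_holomorphic_on scale_fun ?X U"
    by (rule function_ring_tvs_holomorphic_on[OF U])
  have A: "A x \<in> carrier_mat m m" for x
    unfolding A_def case_prod_beta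
    by (intro minus_carrier_mat smult_carrier_mat one_carrier_mat)
  have PA: "?P (\<lambda>x. A x $$ (k, l))" if "k < m" "l < m" for k l
  proof -
    have "A x $$ (k, l) = (if l = m - 1 then - poly.coeff (crit_poly R (fst x)) k
        else if k = l + 1 then 1 else 0) - snd x * (if k = l then 1 else 0)" for x
      using that by (simp add: A_def case_prod_beta companion_def)
    moreover have "?P (\<lambda>x. (if l = m - 1 then - poly.coeff (crit_poly R (fst x)) k
        else if k = l + 1 then 1 else 0) - snd x * (if k = l then 1 else 0))"
      by (intro diff mult const cond uminus unif_holomorphic_on_fst[OF coeffs[OF \<open>k < m\<close>]]
          unif_holomorphic_on_snd[OF continuous_on_id])
    ultimately show ?thesis by (simp only:)
  qed
  \<comment> \<open>Points of the circle lie outside the open disc, which contains all zeros of the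
    critical polynomial.\<close>
  have detA: "Determinant.det (A (w, \<zeta>)) \<noteq> 0" if "w \<in> U" "\<zeta> \<in> ?T" for w \<zeta>
    unfolding A_def prod.case using that
    by (intro det_companion_nonzero degree_crit_poly zeros crit_poly_monic
        poly_crit_poly_nonzero) auto
  have "?P f"
    unfolding f_def
    by (intro mult cofactor[OF A PA] unif_holomorphic_on_inverse det[OF A PA] compact_sphere
        unif_holomorphic_on_eval U ij detA)
  then have "tvs_holomorphic_on scale_fun ?X U
      (\<lambda>w. - (1 / (2 * of_real pi * \<i>)) * contour_integral (circlepath 0 R) (\<lambda>\<zeta>. f (w, \<zeta>)))"
    using \<open>R > 0\<close> by (intro H.mult H.const tvs_holomorphic_on_contour_integral_circlepath U)
  \<comment> \<open>For \<open>w\<close> in \<open>U\<close> the determinant is nonzero on the whole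
    circle, so \<open>f\<close> agrees there with the integrand of \<open>W_matrix\<close>.\<close>
  also have "?this \<longleftrightarrow> ?thesis"
  proof (rule tvs_holomorphic_on_cong)
    fix w assume w: "w \<in> U"
    have "contour_integral (circlepath 0 R) (\<lambda>\<zeta>. f (w, \<zeta>)) =
        contour_integral (circlepath 0 R) (\<lambda>\<zeta>. w \<zeta> *
          (the (mat_inverse (companion m (crit_poly R w) - \<zeta> \<cdot>\<^sub>m 1\<^sub>m m)) $$ (i, j)))"
    proof (rule contour_integral_cong)
      fix \<zeta> assume "\<zeta> \<in> path_image (circlepath 0 R)"
      then have "\<zeta> \<in> ?T"
        using \<open>R > 0\<close> by simp
      from the_mat_inverse_entry[OF A detA[OF w this] ij]
      show "f (w, \<zeta>) = w \<zeta> *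
          (the (mat_inverse (companion m (crit_poly R w) - \<zeta> \<cdot>\<^sub>m 1\<^sub>m m)) $$ (i, j))"
        by (simp add: f_def A_def)
    qed simp
    then show "- (1 / (2 * of_real pi * \<i>)) * contour_integral (circlepath 0 R) (\<lambda>\<zeta>. f (w, \<zeta>)) =
        W_matrix R m w $$ (i, j)"
      using ij by (simp add: W_matrix_def)
  qed
  finally show ?thesis .
qed

theorem proposition6p4:
  fixes \<rho> m :: nat and p R :: real
    and w0 :: "complex \<Rightarrow> complex" and U :: "(complex \<Rightarrow> complex) set"
  assumes "\<rho> \<ge> 1" and "p > 0" and "R > 0"
    and "w0 \<in> E_space \<rho> p"
    and "has_disc_zeros R m (deriv w0)"
    and "CVD_neighborhood \<rho> p R m w0 U"
  shows "tvs_holomorphic_on scale_fun (E_topology \<rho> p) U (CVD R m)"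
proof (cases "m = 0")
  have U: "openin (E_topology \<rho> p) U"
    using assms(6) by (simp add: CVD_neighborhood_def)
  have zeros: "has_disc_zeros R m (deriv w)" if "w \<in> U" for w
    using assms(6) that by (simp add: CVD_neighborhood_def)
  have coeffs: "tvs_holomorphic_on scale_fun (E_topology \<rho> p) U (\<lambda>w. poly.coeff (crit_poly R w) k)"
    if "k < m" for k
    using assms(6) that by (simp add: CVD_neighborhood_def)
  interpret function_ring "tvs_holomorphic_on scale_fun (E_topology \<rho> p) U"
    by (rule function_ring_tvs_holomorphic_on[OF U])
  {
    case True
    then have "CVD R m = (\<lambda>_. 1)"
      by (simp add: CVD_def fun_eq_iff)
    then show ?thesis
      using const[of 1] by simp
  next
    case False
    have entries: "tvs_holomorphic_on scale_fun (E_topology \<rho> p) U (\<lambda>w. W_matrix R m w $$ (i, j))"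
      if "i < m" "j < m" for i j
      by (rule tvs_holomorphic_on_W_matrix_entry[OF \<open>R > 0\<close> U zeros coeffs that])
    have W: "W_matrix R m w \<in> carrier_mat m m" for w
      by (simp add: W_matrix_def)
    \<comment> \<open>The ring is now that of the functionals holomorphic on \<open>U\<close>, and
      the matrix is W(C)(w).\<close>
    have "tvs_holomorphic_on scale_fun (E_topology \<rho> p) U
        (\<lambda>w. discriminant (det_poly m (W_matrix R m w)))"
      by (rule function_ring_discriminant_det_poly[OF function_ring_axioms, where M = "W_matrix R m"])
        (rule W, rule entries)
    moreover have "CVD R m = (\<lambda>w. discriminant (det_poly m (W_matrix R m w)))"
      using False by (simp add: CVD_def fun_eq_iff)
    ultimately show ?thesis
      by simp
  }
qed

end
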